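(* Let $G=(V,E)$ be a simple graph (directed or undirected) with $n$ nodes, let $L$ be its combinatorial Laplacian matrix, and let $\alpha:\mathbb{R}_+\to(0,1]$ be a continuous function. Let $\mathbf{p}_0$ be a real row vector of length $n$ with $\sum_{j=1}^n(\mathbf{p}_0)_j=1$. Then there exists a unique solution, for $t>0$, of the Cauchy problem $$\mathbf{p}'(t)=-\mathbf{p}(t)\,L^{\alpha(t)},\quad t>0,\qquad \mathbf{p}(0)=\mathbf{p}_0 .$$
   Context: A graph is $G=(V,E)$ with $V=\{v_1,\dots,v_n\}$ finite and $E\subseteq V\times V$; it is undirected if $(v_l,v_j)\in E$ implies $(v_j,v_l)\in E$, and directed otherwise. The adjacency matrix $A$ has entries $a_{l,j}=1$ if $(v_l,v_j)\in E$ and $0$ otherwise. The combinatorial Laplacian is $L=D-A$ with $D=\operatorname{diag}(A\mathbf{1})$, where $\mathbf 1$ is the all-ones column vector (so for directed graphs this is the out-degree Laplacian). Here $\mathbb{R}_+=[0,\infty)$, and $\mathbf p(t)$ is a row-vector valued function; a solution is continuous on $[0,\infty)$ and differentiable for $t>0$. The matrix $L^{\alpha}$, $\alpha\in(0,1]$, is the matrix function $f(L)$ for $f(z)=z^\alpha$ (principal branch, $0^\alpha=0$): if $L=Z\operatorname{diag}(J_1,\dots,J_p)Z^{-1}$ is a Jordan decomposition with blocks $J_k$ of size $m_k$ and eigenvalue $\lambda_k$, then $f(L)=Z\operatorname{diag}(f(J_1),\dots,f(J_p))Z^{-1}$, where $f(J_k)$ is the upper triangular Toeplitz matrix whose $j$-th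 superdiagonal is constantly $f^{(j)}(\lambda_k)/j!$, $j=0,\dots,m_k-1$. It is well defined because $z\mapsto z^\alpha$ is defined on the spectrum of $L$, i.e. all the derivatives $f^{(j)}(\lambda_k)$ needed exist (in particular the Jordan blocks of $L$ at the eigenvalue $0$ have size $1$). *)

theory Defs
  imports
    "HOL-Analysis.Analysis"
    "Graph_Theory.Pair_Digraph"
    "Jordan_Normal_Form.Jordan_Normal_Form"
begin

hide_type (open) Finite_Cartesian_Product.vec
hide_const (open) Finite_Cartesian_Product.vec Finite_Cartesian_Product.mat
no_notation Finite_Cartesian_Product.vec_nth (infixl \<open>$\<close> 90)
no_notation Inner_Product.real_inner_class.inner (infix \<open>\<bullet>\<close> 70)

text \<open>
  A simple graph (directed or undirected) is a \<^locale>\<open>pair_digraph\<close>: finite, without loops, its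
  arcs being ordered pairs of vertices; it is undirected if the arc relation is symmetric.
  The function \<open>v\<close> below enumerates the vertices as \<open>v 0, \<dots>, v (n - 1)\<close>.
\<close>

definition adjacency_mat :: "'a pair_pre_digraph \<Rightarrow> nat \<Rightarrow> (nat \<Rightarrow> 'a) \<Rightarrow> real mat" where
  "adjacency_mat G n v = mat n n (\<lambda>(l, j). if (v l, v j) \<in> parcs G then 1 else 0)"

definition laplacian_mat :: "'a pair_pre_digraph \<Rightarrow> nat \<Rightarrow> (nat \<Rightarrow> 'a) \<Rightarrow> real mat" where
  "laplacian_mat G n v =
    (let A = adjacency_mat G n v
     in mat_diag n (\<lambda>l. (A *\<^sub>v vec n (\<lambda>_. 1)) $ l) - A)"

definition fun_jordan_block :: "(complex \<Rightarrow> complex) \<Rightarrow> nat \<Rightarrow> complex \<Rightarrow> complex mat" where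
  "fun_jordan_block f m \<mu> =
    mat m m (\<lambda>(i, j). if i \<le> j then (deriv ^^ (j - i)) f \<mu> / fact (j - i) else 0)"

text \<open>
  \<open>is_matrix_function f A B\<close>: the matrix \<open>B\<close> arises as \<open>f(A)\<close> from some Jordan decomposition
  \<open>A = Z diag(J\<^sub>1, \<dots>, J\<^sub>p) Z\<^sup>-\<^sup>1\<close>, where \<open>bs\<close> lists the pairs (size, eigenvalue) of the blocks and \<open>Z'\<close>
  is the inverse of \<open>Z\<close>. The third conjunct says that \<open>f\<close> is defined on the spectrum: the derivatives
  of order up to \<open>m - 1\<close> exist at the eigenvalue of each block of size \<open>m\<close> (none is required if
  \<open>m = 1\<close>).
\<close>

definition is_matrix_function ::
    "(complex \<Rightarrow> complex) \<Rightarrow> complex mat \<Rightarrow> complex mat \<Rightarrow> bool" where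
  "is_matrix_function f A B \<longleftrightarrow>
    (\<exists>bs Z Z'. 0 \<notin> fst ` set bs \<and>
       similar_mat_wit A (jordan_matrix bs) Z Z' \<and>
       (\<forall>(m, \<mu>) \<in> set bs. \<forall>j. Suc j < m \<longrightarrow> (deriv ^^ j) f field_differentiable (at \<mu>)) \<and>
       B = Z * diag_block_mat (map (\<lambda>(m, \<mu>). fun_jordan_block f m \<mu>) bs) * Z')"

definition matrix_function :: "(complex \<Rightarrow> complex) \<Rightarrow> complex mat \<Rightarrow> complex mat" where
  "matrix_function f A = (THE B. is_matrix_function f A B)"

text \<open>\<^const>\<open>powr\<close> on the complex numbers is the principal branch, with \<open>0 powr a = 0\<close>.\<close>

definition mat_powr :: "real mat \<Rightarrow> real \<Rightarrow> complex mat" where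
  "mat_powr L a = matrix_function (\<lambda>z. z powr complex_of_real a) (map_mat complex_of_real L)"

definition row_mult :: "'b :: semiring_0 vec \<Rightarrow> 'b mat \<Rightarrow> 'b vec" where
  "row_mult p M = vec (dim_col M) (\<lambda>j. p \<bullet> col M j)"

text \<open>
  The solution is real valued; the equation is an equation of complex row vectors because
  \<^const>\<open>mat_powr\<close> is a complex matrix. The type of vectors of variable dimension carries no
  topology, so continuity and derivatives are taken entrywise. The values of \<open>p\<close> at negative times
  are irrelevant.
\<close>

definition cauchy_solution ::
    "nat \<Rightarrow> real mat \<Rightarrow> (real \<Rightarrow> real) \<Rightarrow> real vec \<Rightarrow> (real \<Rightarrow> real vec) \<Rightarrow> bool" where
  "cauchy_solution n L \<alpha> p0 p \<longleftrightarrow>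
    (\<forall>t\<ge>0. p t \<in> carrier_vec n) \<and>
    (\<forall>j<n. continuous_on {0..} (\<lambda>t. p t $ j)) \<and>
    (\<exists>p' :: real \<Rightarrow> real vec. \<forall>t>0. p' t \<in> carrier_vec n \<and>
       (\<forall>j<n. ((\<lambda>s. p s $ j) has_real_derivative p' t $ j) (at t)) \<and>
       map_vec complex_of_real (p' t)
         = - row_mult (map_vec complex_of_real (p t)) (mat_powr L (\<alpha> t))) \<and>
    p 0 = p0"

end

theory Submission
  imports Defs
    "HOL-Complex_Analysis.Complex_Analysis"
    "Jordan_Normal_Form.Jordan_Normal_Form_Uniqueness"
    "Jordan_Normal_Form.Jordan_Normal_Form_Existence"
begin

text \<open>
  Let \<open>c > n\<close> and \<open>H = L - c I\<close>. The absolute row sums of \<open>H\<close> are \<open>c\<close>, so the entries of \<open>H\<^sup>k\<close> are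
  bounded by \<open>c\<^sup>k\<close>. Reading this off a Jordan form of \<open>L\<close> shows that each eigenvalue \<open>\<mu>\<close> either
  satisfies \<open>|\<mu> - c| < c\<close> or is \<open>0\<close> with blocks of size 1. In both cases the Taylor series of \<open>z\<^sup>a\<close> at \<open>c\<close>
  converges on the Jordan blocks (at \<open>\<mu> = 0\<close> because \<open>\<Sum> (-1)\<^sup>k (a choose k)\<close> converges absolutely to
  \<open>0\<close>), so for every Jordan decomposition \<open>L\<^sup>a\<close> equals the real series
  \<open>\<Sum> (a choose k) c\<^sup>a\<^sup>-\<^sup>k H\<^sup>k\<close>. Hence \<open>L\<^sup>a\<close> is well defined, real, bounded, and continuous in
  \<open>a \<in> (0, 1]\<close>, and the Cauchy problem is a linear equation with bounded continuous coefficients.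
\<close>

(* Merging Defs with the other imports brings these names and notations back. *)
hide_type (open) Finite_Cartesian_Product.vec
hide_const (open) Finite_Cartesian_Product.vec Finite_Cartesian_Product.mat
no_notation Finite_Cartesian_Product.vec_nth (infixl \<open>$\<close> 90)
no_notation Inner_Product.real_inner_class.inner (infix \<open>\<bullet>\<close> 70)
no_notation fps_nth (infixl \<open>$\<close> 75)

section \<open>Linear differential equations with bounded coefficients\<close>

text \<open>These are the summands of the Peano-Baker series, that is, the differences of successive
  Picard iterates, for the row-vector equation \<open>p' = p m\<close>. The solution is their sum
  over \<open>k\<close>.\<close>

primrec picard :: "nat \<Rightarrow> (nat \<Rightarrow> nat \<Rightarrow> real \<Rightarrow> real) \<Rightarrow> (nat \<Rightarrow> real) \<Rightarrow> nat \<Rightarrow> nat \<Rightarrow> real \<Rightarrow> real" where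
  "picard n m a 0 = (\<lambda>j t. a j)"
| "picard n m a (Suc k) = (\<lambda>j t. integral {0..t} (\<lambda>s. \<Sum>i<n. picard n m a k i s * m i j s))"

lemma picard_has_derivative:
  assumes cont: "\<And>i j. i < n \<Longrightarrow> j < n \<Longrightarrow> continuous_on {0..} (m i j)"
    and j: "j < n"
  shows "continuous_on {0..T} (picard n m a k j)"
    and "t \<in> {0..T} \<Longrightarrow> (picard n m a (Suc k) j has_real_derivative
           (\<Sum>i<n. picard n m a k i t * m i j t)) (at t within {0..T})"
proof -
  have cont': "continuous_on {0..T} (m i j)" if "i < n" "j < n" for i j
    using cont[OF that] by (rule continuous_on_subset) auto
  have der: "(picard n m a (Suc k) j has_real_derivative
      (\<Sum>i<n. picard n m a k i t * m i j t)) (at t within {0..T})"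
    if "\<And>i. i < n \<Longrightarrow> continuous_on {0..T} (picard n m a k i)" "j < n" "t \<in> {0..T}" for k j t
    unfolding picard.simps
    by (rule integral_has_real_derivative) (use that cont' in \<open>auto intro!: continuous_intros\<close>)
  have c: "continuous_on {0..T} (picard n m a k j)" if "j < n" for k j
    using that
  proof (induction k arbitrary: j)
    case (Suc k)
    show ?case
      by (rule DERIV_continuous_on) (rule der, use Suc in auto)
  qed simp
  show "continuous_on {0..T} (picard n m a k j)" using c j by blast
  show "t \<in> {0..T} \<Longrightarrow> (picard n m a (Suc k) j has_real_derivative
           (\<Sum>i<n. picard n m a k i t * m i j t)) (at t within {0..T})"
    by (rule der) (use c j in auto)
qed

lemma abs_sum_mult_le:
  fixes x y :: "nat \<Rightarrow> real"
  assumes "\<And>i. i < n \<Longrightarrow> \<bar>x i\<bar> \<le> C" "\<And>i. i < n \<Longrightarrow> \<bar>y i\<bar> \<le> B"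
  shows "\<bar>\<Sum>i<n. x i * y i\<bar> \<le> real n * B * C"
proof -
  have "\<bar>\<Sum>i<n. x i * y i\<bar> \<le> (\<Sum>i<n. \<bar>x i * y i\<bar>)" by (rule sum_abs)
  also have "\<dots> \<le> (\<Sum>i<n. C * B)"
    by (rule sum_mono) (use assms in \<open>auto simp: abs_mult intro!: mult_mono' order_trans[OF abs_ge_zero]\<close>)
  finally show ?thesis by (simp add: mult_ac)
qed

text \<open>Integrating \<open>n * B\<close> times the bound at \<open>k\<close> yields the bound at
  \<open>k + 1\<close>: with \<open>K = n * B\<close>, the terms are dominated by those of
  \<open>A * exp (K * t)\<close>.\<close>

lemma picard_bound:
  assumes cont: "\<And>i j. i < n \<Longrightarrow> j < n \<Longrightarrow> continuous_on {0..} (m i j)"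
    and bound: "\<And>i j t. i < n \<Longrightarrow> j < n \<Longrightarrow> 0 \<le> t \<Longrightarrow> \<bar>m i j t\<bar> \<le> B"
    and a: "\<And>j. j < n \<Longrightarrow> \<bar>a j\<bar> \<le> A"
    and j: "j < n" and t: "0 \<le> t"
  shows "\<bar>picard n m a k j t\<bar> \<le> A * (real n * B * t) ^ k / fact k"
  using j t
proof (induction k arbitrary: j t)
  case 0
  then show ?case using a by simp
next
  case (Suc k)
  let ?K = "real n * B"
  let ?f = "\<lambda>s. \<Sum>i<n. picard n m a k i s * m i j s"
  have cont': "continuous_on {0..t} (m i j)" if "i < n" for i
    using cont[OF that \<open>j < n\<close>] by (rule continuous_on_subset) auto
  have "continuous_on {0..t} ?f"
    using picard_has_derivative(1)[of n m, OF cont] cont'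
    by (auto intro!: continuous_intros)
  then have int: "?f integrable_on {0..t}" by (rule integrable_continuous_interval)
  have le: "norm (?f s) \<le> ?K * (A * (?K * s) ^ k / fact k)" if "s \<in> {0..t}" for s
    unfolding real_norm_def
    by (rule abs_sum_mult_le) (use Suc bound that in auto)
  have "((\<lambda>s. ?K * (A * (?K * s) ^ k / fact k)) has_integral
      A * (?K * t) ^ Suc k / fact (Suc k) - A * (?K * 0) ^ Suc k / fact (Suc k)) {0..t}"
  proof (rule fundamental_theorem_of_calculus)
    fix s
    have "((\<lambda>s. A * (?K * s) ^ Suc k / fact (Suc k)) has_real_derivative
        A * ((1 + real k) * (?K * (?K * s) ^ k)) / fact (Suc k)) (at s within {0..t})"
      by (intro DERIV_cdivide DERIV_cmult DERIV_power_Suc DERIV_cmult_Id)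
    moreover have "A * ((1 + real k) * (?K * (?K * s) ^ k)) / fact (Suc k)
        = ?K * (A * (?K * s) ^ k / fact k)"
      by (simp add: fact_Suc divide_simps)
    ultimately show "((\<lambda>s. A * (?K * s) ^ Suc k / fact (Suc k)) has_vector_derivative
        ?K * (A * (?K * s) ^ k / fact k)) (at s within {0..t})"
      by (simp only: has_real_derivative_iff_has_vector_derivative)
  qed (use Suc in auto)
  then have "norm (integral {0..t} ?f) \<le> A * (?K * t) ^ Suc k / fact (Suc k)"
    using integral_norm_bound_integral[OF int _ le]
    by (simp add: has_integral_iff)
  then show ?case by simp
qed

text \<open>The sum of the \<open>picard\<close> terms is differentiated term by term. The
  derivative is taken within \<open>{0..}\<close>, so it is one-sided at 0 and also yields
  continuity of the solution there.\<close>

lemma linear_ode_exists: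
  fixes m :: "nat \<Rightarrow> nat \<Rightarrow> real \<Rightarrow> real"
  assumes cont: "\<And>i j. i < n \<Longrightarrow> j < n \<Longrightarrow> continuous_on {0..} (m i j)"
    and bound: "\<And>i j t. i < n \<Longrightarrow> j < n \<Longrightarrow> 0 \<le> t \<Longrightarrow> \<bar>m i j t\<bar> \<le> B"
  obtains p where "\<And>j. j < n \<Longrightarrow> p j 0 = a j"
    and "\<And>j t. j < n \<Longrightarrow> 0 \<le> t \<Longrightarrow>
      (p j has_real_derivative (\<Sum>i<n. p i t * m i j t)) (at t within {0..})"
proof
  define q where "q = picard n m a"
  define p where "p = (\<lambda>j t. \<Sum>k. q k j t)"
  define A where "A = (\<Sum>i<n. \<bar>a i\<bar>)"
  have A: "\<bar>a j\<bar> \<le> A" if "j < n" for j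
    unfolding A_def by (rule member_le_sum) (use that in auto)
  have q_bound: "\<bar>q k j t\<bar> \<le> A * (real n * B * t) ^ k / fact k" if "j < n" "0 \<le> t" for k j t
    unfolding q_def by (rule picard_bound[OF cont bound A that])
  have sm: "summable (\<lambda>k. A * (real n * B * t) ^ k / fact k)" for t
    using summable_mult[OF summable_exp[of "real n * B * t"], of A]
    by (simp add: field_simps)
  have q_summable: "summable (\<lambda>k. q k j t)" if "j < n" "0 \<le> t" for j t
    by (rule summable_comparison_test'[OF sm]) (use q_bound[OF that] in auto)
  show "p j 0 = a j" if "j < n" for j
  proof -
    have "q k j 0 = (if k = 0 then a j else 0)" for k
      by (cases k) (auto simp: q_def)
    then show ?thesis
      using sums_single[of 0 "\<lambda>_. a j"] unfolding p_def by (simp add: sums_iff)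
  qed
  show "(p j has_real_derivative (\<Sum>i<n. p i t * m i j t)) (at t within {0..})"
    if j: "j < n" and t: "0 \<le> t" for j t
  proof -
    \<comment> \<open>Boundedness of the interval makes the majorant uniform in \<open>s\<close>.
      Its extension beyond \<open>t\<close> makes the filters at \<open>t\<close> within
      \<open>?S\<close> and within \<open>{0..}\<close> coincide.\<close>
    let ?S = "{0..t + 1}"
    let ?f' = "\<lambda>k s. \<Sum>i<n. q k i s * m i j s"
    have B: "0 \<le> B" using bound[OF j j, of 0] by simp
    have A0: "0 \<le> A" using A[OF j] by simp
    have "\<bar>?f' k s\<bar> \<le> real n * B * (A * (real n * B * (t + 1)) ^ k / fact k)" if "s \<in> ?S" for k s
    proof (rule abs_sum_mult_le)
      fix i assume i: "i < n"
      have "\<bar>q k i s\<bar> \<le> A * (real n * B * s) ^ k / fact k" using q_bound i that by simp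
      also have "\<dots> \<le> A * (real n * B * (t + 1)) ^ k / fact k"
        using A0 B that by (intro divide_right_mono mult_left_mono power_mono) auto
      finally show "\<bar>q k i s\<bar> \<le> A * (real n * B * (t + 1)) ^ k / fact k" .
    qed (use bound j that in auto)
    then have ul: "uniform_limit ?S (\<lambda>N s. \<Sum>k<N. ?f' k s) (\<lambda>s. \<Sum>k. ?f' k s) sequentially"
      by (intro Weierstrass_m_test[OF _ summable_mult[OF sm]]) auto
    \<comment> \<open>The term of index 0 is the constant \<open>a j\<close>. It is split off,
      because only the terms \<open>Suc k\<close> have derivatives of the form \<open>?f' k\<close>;
      hence \<open>p j = g + a j\<close> below.\<close>
    have "\<exists>g. \<forall>s\<in>?S. (\<lambda>k. q (Suc k) j s) sums g s \<and>
        (g has_real_derivative (\<Sum>k. ?f' k s)) (at s within ?S)"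
    proof (rule has_field_derivative_series[OF _ _ ul])
      show "(q (Suc k) j has_real_derivative ?f' k s) (at s within ?S)" if "s \<in> ?S" for k s
        unfolding q_def by (rule picard_has_derivative(2)) (use cont j that in auto)
      show "(0::real) \<in> ?S" "summable (\<lambda>k. q (Suc k) j 0)"
        using t q_summable[OF j, of 0] by (auto simp del: picard.simps simp: summable_Suc_iff[of "\<lambda>k. q k j 0"])
    qed simp
    then obtain g where g: "\<And>s. s \<in> ?S \<Longrightarrow> (\<lambda>k. q (Suc k) j s) sums g s"
        "\<And>s. s \<in> ?S \<Longrightarrow> (g has_real_derivative (\<Sum>k. ?f' k s)) (at s within ?S)"
      by blast
    have p_eq: "p j s = g s + a j" if "s \<in> ?S" for s
    proof -
      have "(\<lambda>k. q k j s) sums (g s + q 0 j s)" by (rule sums_Suc) (rule g[OF that])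
      then show ?thesis by (simp add: p_def sums_iff q_def)
    qed
    have "((\<lambda>s. g s + a j) has_real_derivative (\<Sum>k. ?f' k t) + 0) (at t within ?S)"
      by (intro DERIV_add g(2) DERIV_const) (use t in auto)
    then have "(p j has_real_derivative (\<Sum>k. ?f' k t)) (at t within ?S)"
      unfolding add_0_right
      by (rule has_field_derivative_transform_within[where d = 1]) (simp_all add: p_eq t)
    moreover have "at t within ?S = at t within {0..}"
      by (rule at_within_nhd[of _ "{..<t + 1}"]) auto
    moreover have "(\<Sum>k. ?f' k t) = (\<Sum>i<n. p i t * m i j t)"
    proof -
      have "(\<lambda>k. ?f' k t) sums (\<Sum>i<n. p i t * m i j t)"
        unfolding p_def
        by (intro sums_sum sums_mult2 summable_sums q_summable) (use t in auto)
      then show ?thesis by (simp add: sums_iff)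
    qed
    ultimately show ?thesis by simp
  qed
qed

lemma linear_ode_unique:
  fixes r :: "nat \<Rightarrow> real \<Rightarrow> real" and m :: "nat \<Rightarrow> nat \<Rightarrow> real \<Rightarrow> real"
  assumes cont: "\<And>j. j < n \<Longrightarrow> continuous_on {0..} (r j)"
    and bound: "\<And>i j t. i < n \<Longrightarrow> j < n \<Longrightarrow> 0 < t \<Longrightarrow> \<bar>m i j t\<bar> \<le> B"
    and der: "\<And>j t. j < n \<Longrightarrow> 0 < t \<Longrightarrow> (r j has_real_derivative (\<Sum>i<n. r i t * m i j t)) (at t)"
    and zero: "\<And>j. j < n \<Longrightarrow> r j 0 = 0"
    and j: "j < n" and t: "0 \<le> t"
  shows "r j t = 0"
proof -
  \<comment> \<open>Gronwall's argument for the squared Euclidean norm\<close>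
  define u where "u = (\<lambda>s. \<Sum>j<n. (r j s)\<^sup>2)"
  \<comment> \<open>The constant arises by summing
    \<open>2 * r j * r i * m i j \<le> B * ((r j)^2 + (r i)^2)\<close> over all pairs, which bounds
    the derivative of \<open>u\<close> by \<open>K * u\<close>. The integrating factor in
    \<open>v\<close> then makes \<open>v\<close> nonincreasing.\<close>
  define K where "K = 2 * real n * B"
  define v where "v = (\<lambda>s. u s * exp (- (K * s)))"
  have "v 0 \<ge> v t"
  \<comment> \<open>The equation holds at positive times only, so the derivative is examined on the
    open interval and continuity covers the endpoint 0.\<close>
  proof (rule DERIV_nonpos_imp_decreasing_open[OF t])
    fix s :: real assume s: "0 < s"
    define D where "D = (\<Sum>j<n. 2 * (r j s * (\<Sum>i<n. r i s * m i j s)))"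
    have u': "(u has_real_derivative D) (at s)"
      unfolding u_def D_def
      by (intro DERIV_sum) (auto intro!: derivative_eq_intros der s)
    have "D = (\<Sum>j<n. \<Sum>i<n. 2 * r j s * r i s * m i j s)"
      unfolding D_def by (simp add: sum_distrib_left mult_ac)
    also have "\<dots> \<le> (\<Sum>j<n. \<Sum>i<n. B * ((r j s)\<^sup>2 + (r i s)\<^sup>2))"
    proof (intro sum_mono)
      fix j i assume "j \<in> {..<n}" "i \<in> {..<n}"
      then have b: "\<bar>m i j s\<bar> \<le> B" using bound s by auto
      have "\<bar>2 * r j s * r i s\<bar> \<le> (r j s)\<^sup>2 + (r i s)\<^sup>2"
        using sum_squares_bound[of "\<bar>r j s\<bar>" "\<bar>r i s\<bar>"] by (simp add: abs_mult)
      then have "\<bar>2 * r j s * r i s\<bar> * \<bar>m i j s\<bar> \<le> ((r j s)\<^sup>2 + (r i s)\<^sup>2) * B"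
        using b by (intro mult_mono) auto
      then show "2 * r j s * r i s * m i j s \<le> B * ((r j s)\<^sup>2 + (r i s)\<^sup>2)"
        by (simp add: mult_ac flip: abs_mult)
    qed
    also have "\<dots> = K * u s"
      unfolding K_def u_def
      by (simp add: sum.distrib distrib_left sum_distrib_left mult_ac)
    finally have D: "D \<le> K * u s" .
    have "(v has_real_derivative D * exp (- (K * s)) + u s * (exp (- (K * s)) * (- K))) (at s)"
      unfolding v_def by (auto intro!: derivative_eq_intros u')
    moreover have "D * exp (- (K * s)) + u s * (exp (- (K * s)) * (- K)) = (D - K * u s) * exp (- (K * s))"
      by (simp add: algebra_simps)
    moreover have "\<dots> \<le> 0" using D by (simp add: mult_le_0_iff)
    ultimately show "\<exists>y. (v has_real_derivative y) (at s) \<and> y \<le> 0" by metis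
  next
    have "continuous_on {0..t} (r j)" if "j < n" for j
      using cont[OF that] by (rule continuous_on_subset) auto
    then show "continuous_on {0..t} v"
      unfolding v_def u_def by (auto intro!: continuous_intros)
  qed
  moreover have "v 0 = 0" by (simp add: v_def u_def zero)
  ultimately have "u t \<le> 0" by (simp add: v_def mult_le_0_iff)
  moreover have "(r j t)\<^sup>2 \<le> u t"
    unfolding u_def by (rule member_le_sum) (use j in auto)
  ultimately have "(r j t)\<^sup>2 \<le> 0" by linarith
  then show ?thesis by simp
qed

section \<open>The Taylor series of the power function\<close>

text \<open>For \<open>a\<close> in [0,1] every factor of the product is nonnegative. In this form
  one sees that all alternating binomial terms after index 0 have the same sign.\<close>

lemma gbinomial_alternating_eq_prod:
  fixes a :: real
  shows "(a gchoose Suc k) * (- 1) ^ Suc k = - (a / real (Suc k) * (\<Prod>i=1..k. 1 - a / real i))"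
proof (induction k)
  case (Suc k)
  have "(a gchoose Suc (Suc k)) * (- 1) ^ Suc (Suc k)
      = ((a gchoose Suc k) * (- 1) ^ Suc k) * ((real (Suc k) - a) / real (Suc (Suc k)))"
  proof -
    have "(a gchoose Suc (Suc k)) = (a gchoose Suc k) * ((a - real (Suc k)) / real (Suc (Suc k)))"
      using gbinomial_mult_1[of a "Suc k"] by (simp add: field_simps)
    moreover have "(real (Suc k) - a) / real (Suc (Suc k)) = - ((a - real (Suc k)) / real (Suc (Suc k)))"
      by (simp add: diff_divide_distrib)
    ultimately show ?thesis by (simp only: power_Suc[of _ "Suc k"]) simp
  qed
  also have "\<dots> = - (a / real (Suc (Suc k)) * ((\<Prod>i=1..k. 1 - a / real i) * (1 - a / real (Suc k))))"
    unfolding Suc.IH by (simp add: divide_simps) 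
  finally show ?case by simp
qed simp

text \<open>With \<open>P\<close> the product up to \<open>m\<close>, the next term is
  \<open>- a / (m + 1) * P\<close>, and adding it to \<open>P\<close> multiplies \<open>P\<close> by
  the next factor.\<close>

lemma gbinomial_alternating_partial_sum:
  fixes a :: real
  shows "(\<Sum>k\<le>m. (a gchoose k) * (- 1) ^ k) = (\<Prod>i=1..m. 1 - a / real i)"
proof (induction m)
  case (Suc m)
  have "(\<Sum>k\<le>Suc m. (a gchoose k) * (- 1) ^ k) = (\<Prod>i=1..m. 1 - a / real i) + (a gchoose Suc m) * (- 1) ^ Suc m"
    by (simp only: sum.atMost_Suc Suc.IH)
  also have "\<dots> = (\<Prod>i=1..Suc m. 1 - a / real i)"
    unfolding gbinomial_alternating_eq_prod by (simp add: field_simps)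
  finally show ?case .
qed simp

lemma prod_one_minus_bounds:
  fixes a :: real
  assumes "0 \<le> a" "a \<le> 1"
  shows "0 \<le> (\<Prod>i=1..m. 1 - a / real i)" "(\<Prod>i=1..m. 1 - a / real i) \<le> 1"
  using assms by (auto intro!: prod_nonneg prod_le_1 simp: field_simps)

lemma abs_gbinomial:
  fixes a :: real
  assumes "0 \<le> a" "a \<le> 1"
  shows "\<bar>a gchoose Suc k\<bar> = a / real (Suc k) * (\<Prod>i=1..k. 1 - a / real i)"
proof -
  have "\<bar>a gchoose Suc k\<bar> = \<bar>(a gchoose Suc k) * (- 1) ^ Suc k\<bar>"
    by (simp add: abs_mult power_abs del: power_Suc)
  also have "\<dots> = a / real (Suc k) * (\<Prod>i=1..k. 1 - a / real i)"
    unfolding gbinomial_alternating_eq_prod abs_minus_cancel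
    using assms prod_one_minus_bounds(1)[OF assms, of k] by (intro abs_of_nonneg mult_nonneg_nonneg) auto
  finally show ?thesis .
qed

text \<open>The product in \<open>abs_gbinomial\<close> decreases in \<open>a\<close>, and the
  remaining factor \<open>a\<close> is at most 1. The bound is a majorant common to all exponents in
  \<open>[b, 1]\<close>, as continuity in the exponent requires.\<close>

lemma abs_gbinomial_le:
  fixes a b :: real
  assumes "0 < b" "b \<le> a" "a \<le> 1"
  shows "\<bar>a gchoose k\<bar> \<le> \<bar>b gchoose k\<bar> / b"
proof (cases k)
  case (Suc k')
  have "(\<Prod>i=1..k'. 1 - a / real i) \<le> (\<Prod>i=1..k'. 1 - b / real i)"
    using assms by (intro prod_mono) (auto simp: field_simps)
  then have "a / real k * (\<Prod>i=1..k'. 1 - a / real i) \<le> 1 / real k * (\<Prod>i=1..k'. 1 - b / real i)"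
    using assms prod_one_minus_bounds[of a k'] by (intro mult_mono divide_right_mono) auto
  also have "\<dots> = \<bar>b gchoose k\<bar> / b"
    using assms unfolding Suc by (subst abs_gbinomial) auto
  finally show ?thesis
    using assms unfolding Suc by (subst abs_gbinomial) auto
qed (use assms in auto)

text \<open>By the constant sign, the absolute values of the terms of index 1 to \<open>m\<close>
  add up to 1 minus a product in [0,1]. The term of index 0 contributes the other 1.\<close>

lemma summable_abs_gbinomial:
  fixes a :: real
  assumes "0 \<le> a" "a \<le> 1"
  shows "summable (\<lambda>k. \<bar>a gchoose k\<bar>)" and "(\<Sum>k. \<bar>a gchoose k\<bar>) \<le> 2"
proof -
  have le: "(\<Sum>k<m. \<bar>a gchoose Suc k\<bar>) \<le> 1" for m
  proof -
    have "(\<Sum>k<m. \<bar>a gchoose Suc k\<bar>) = - (\<Sum>k<m. (a gchoose Suc k) * (- 1) ^ Suc k)"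
      unfolding abs_gbinomial[OF assms] gbinomial_alternating_eq_prod by (simp add: sum_negf)
    also have "(\<Sum>k<m. (a gchoose Suc k) * (- 1) ^ Suc k) = (\<Sum>k\<le>m. (a gchoose k) * (- 1) ^ k) - 1"
      by (subst sum.atMost_shift) simp
    also have "- \<dots> \<le> 1"
      unfolding gbinomial_alternating_partial_sum using prod_one_minus_bounds[OF assms, of m] by simp
    finally show ?thesis .
  qed
  have s: "summable (\<lambda>k. \<bar>a gchoose Suc k\<bar>)"
    by (rule summableI_nonneg_bounded[where x = 1]) (use le in auto)
  then show sm: "summable (\<lambda>k. \<bar>a gchoose k\<bar>)" by (simp add: summable_Suc_iff[of "\<lambda>k. \<bar>a gchoose k\<bar>"])
  have "(\<Sum>k. \<bar>a gchoose Suc k\<bar>) \<le> 1" by (rule suminf_le_const[OF s]) (use le in auto)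
  then show "(\<Sum>k. \<bar>a gchoose k\<bar>) \<le> 2" using suminf_split_head[OF sm] by simp
qed

text \<open>By \<open>1 - x \<le> exp (- x)\<close> the partial sums, which are products, are at
  most \<open>exp (- a * harm m)\<close>, and the harmonic series diverges. For \<open>a = 0\<close>
  the sum would be 1.\<close>

lemma gbinomial_alternating_sums_zero:
  fixes a :: real
  assumes "0 < a" "a \<le> 1"
  shows "(\<lambda>k. (a gchoose k) * (- 1) ^ k) sums 0"
proof -
  have le: "(\<Prod>i=1..m. 1 - a / real i) \<le> exp (- (a * harm m))" for m
  proof -
    have "(\<Prod>i=1..m. 1 - a / real i) \<le> (\<Prod>i=1..m. exp (- (a / real i)))"
    proof (rule prod_mono)
      fix i assume "i \<in> {1..m}"
      then show "0 \<le> 1 - a / real i \<and> 1 - a / real i \<le> exp (- (a / real i))"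
        using assms exp_ge_add_one_self[of "- (a / real i)"] by (auto simp: field_simps)
    qed
    also have "\<dots> = exp (- (a * harm m))"
      by (simp add: exp_sum[symmetric] harm_def sum_distrib_left sum_negf divide_inverse)
    finally show ?thesis .
  qed
  have "filterlim (\<lambda>m. a * harm m) at_top sequentially"
    by (rule filterlim_tendsto_pos_mult_at_top[OF tendsto_const _ harm_at_top]) (use assms in auto)
  then have "(\<lambda>m. exp (- (a * harm m))) \<longlonglongrightarrow> 0"
    by (intro filterlim_compose[OF exp_at_bot]) (simp add: filterlim_uminus_at_bot)
  then have "(\<lambda>m. \<Prod>i=1..m. 1 - a / real i) \<longlonglongrightarrow> 0"
    by (rule tendsto_sandwich[rotated 2, OF tendsto_const])
       (use le prod_one_minus_bounds[of a] assms in auto)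
  then show ?thesis
    unfolding sums_def_le gbinomial_alternating_partial_sum .
qed

section \<open>Derivatives and Taylor expansion of the complex power function\<close>

lemma complex_gbinomial_of_real: "(complex_of_real a gchoose k) = complex_of_real (a gchoose k)"
  by (simp add: gbinomial_prod_rev)

lemma higher_deriv_powr:
  fixes z :: complex
  assumes "z \<notin> \<real>\<^sub>\<le>\<^sub>0"
  shows "(deriv ^^ k) (\<lambda>z. z powr a) z = (a gchoose k) * fact k * z powr (a - of_nat k)"
  using assms
proof (induction k arbitrary: z)
  case (Suc k)
  \<comment> \<open>The formula of order \<open>k\<close> can be differentiated at \<open>z\<close>
    because it holds on a neighbourhood of \<open>z\<close>, the complement of the branch cut being
    open.\<close>
  have "eventually (\<lambda>w. w \<in> - \<real>\<^sub>\<le>\<^sub>0) (nhds z)"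
    by (rule eventually_nhds_in_open) (use Suc.prems open_Compl[OF closed_nonpos_Reals_complex] in auto)
  then have "eventually (\<lambda>w. (deriv ^^ k) (\<lambda>z. z powr a) w = (a gchoose k) * fact k * w powr (a - of_nat k)) (nhds z)"
    by eventually_elim (use Suc.IH in auto)
  then have "(deriv ^^ Suc k) (\<lambda>z. z powr a) z
      = deriv (\<lambda>w. (a gchoose k) * fact k * w powr (a - of_nat k)) z"
    by (simp add: deriv_cong_ev)
  also have "\<dots> = (a gchoose k) * fact k * ((a - of_nat k) * z powr (a - of_nat k - 1))"
    by (rule DERIV_imp_deriv) (auto intro!: derivative_eq_intros has_field_derivative_powr Suc.prems)
  also have "\<dots> = ((a - of_nat k) * (a gchoose k)) * fact k * z powr (a - of_nat (Suc k))"
    by (simp add: algebra_simps)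
  also have "(a - of_nat k) * (a gchoose k) = of_nat (Suc k) * (a gchoose Suc k)"
    using gbinomial_mult_1[of a k] by (simp add: algebra_simps)
  also have "\<dots> * fact k * z powr (a - of_nat (Suc k)) = (a gchoose Suc k) * fact (Suc k) * z powr (a - of_nat (Suc k))"
    by (simp add: algebra_simps)
  finally show ?case .
qed simp

definition taylor_coeff :: "real \<Rightarrow> real \<Rightarrow> nat \<Rightarrow> real" where
  "taylor_coeff c a k = (a gchoose k) * c powr a / c ^ k"

lemma ball_disjoint_nonpos: 
  assumes "z \<in> ball (complex_of_real c) c"
  shows "z \<notin> \<real>\<^sub>\<le>\<^sub>0"
proof
  assume "z \<in> \<real>\<^sub>\<le>\<^sub>0"
  then have "Re z \<le> 0" by (auto elim!: nonpos_Reals_cases)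
  moreover have "\<bar>Re (of_real c - z)\<bar> < c"
    using assms abs_Re_le_cmod[of "of_real c - z"] by (auto simp: dist_norm)
  ultimately show False by auto
qed

lemma powr_holomorphic_on_ball: "(\<lambda>z. z powr a) holomorphic_on ball (complex_of_real c) c"
  by (intro holomorphic_intros) (use ball_disjoint_nonpos in blast)

text \<open>The factor after the coefficient is the entry on the \<open>d\<close>-th superdiagonal
  of the \<open>k\<close>-th power of a Jordan block with eigenvalue \<open>z - c\<close>. The
  identity comes from expanding the \<open>d\<close>-th derivative itself at
  \<open>c\<close>.\<close>

lemma taylor_coeff_block_sums:
  assumes c: "0 < c" and z: "cmod (z - of_real c) < c"
  shows "(\<lambda>k. of_real (taylor_coeff c a k) * (of_nat (k choose d) * (z - of_real c) ^ (k - d)))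
     sums ((deriv ^^ d) (\<lambda>z. z powr of_real a) z / fact d)"
proof -
  let ?f = "\<lambda>z. z powr complex_of_real a"
  have nonpos: "complex_of_real c \<notin> \<real>\<^sub>\<le>\<^sub>0" using c by simp
  have coeff: "(deriv ^^ k) ?f (of_real c) = of_real (taylor_coeff c a k) * fact k" for k
  proof -
    have "complex_of_real c powr (of_real a - of_nat k) = of_real (c powr a / c ^ k)"
      using c by (simp add: powr_diff powr_of_real powr_nat)
    then show ?thesis
      unfolding higher_deriv_powr[OF nonpos] complex_gbinomial_of_real taylor_coeff_def by simp
  qed
  have "(\<lambda>k. (deriv ^^ k) ((deriv ^^ d) ?f) (of_real c) / fact k * (z - of_real c) ^ k) sums (deriv ^^ d) ?f z"
    by (rule holomorphic_power_series[where r = c])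
       (use z in \<open>auto intro!: holomorphic_higher_deriv powr_holomorphic_on_ball simp: dist_norm norm_minus_commute\<close>)
  then have "(\<lambda>k. (deriv ^^ k) ((deriv ^^ d) ?f) (of_real c) / fact k * (z - of_real c) ^ k / fact d)
      sums ((deriv ^^ d) ?f z / fact d)"
    by (rule sums_divide)
  also have "(\<lambda>k. (deriv ^^ k) ((deriv ^^ d) ?f) (of_real c) / fact k * (z - of_real c) ^ k / fact d)
    = (\<lambda>k. of_real (taylor_coeff c a (k + d)) * (of_nat ((k + d) choose d) * (z - of_real c) ^ (k + d - d)))"
  proof
    fix k
    have "(deriv ^^ k) ((deriv ^^ d) ?f) (of_real c) = of_real (taylor_coeff c a (k + d)) * fact (k + d)"
      using coeff[of "k + d"] by (simp add: funpow_add)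
    moreover have "(of_nat ((k + d) choose d) :: complex) = fact (k + d) / (fact d * fact k)"
      by (simp add: binomial_fact)
    ultimately show "(deriv ^^ k) ((deriv ^^ d) ?f) (of_real c) / fact k * (z - of_real c) ^ k / fact d
      = of_real (taylor_coeff c a (k + d)) * (of_nat ((k + d) choose d) * (z - of_real c) ^ (k + d - d))"
      by (simp add: mult_ac)
  qed
  \<comment> \<open>The series obtained starts at index \<open>d\<close>. The terms with
    \<open>k < d\<close> vanish since \<open>k choose d = 0\<close>, so the truncated exponent
    \<open>k - d\<close> does no harm there.\<close>
  finally show ?thesis
    by (subst (asm) sums_iff_shift) (simp add: binomial_eq_0)
qed

text \<open>The point \<open>z = 0\<close> lies on the boundary of the disc about \<open>c\<close>,
  beyond the reach of the holomorphic expansion. The series there is \<open>c powr a\<close> times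
  the alternating binomial series.\<close>

lemma taylor_coeff_sums_zero:
  assumes "0 < c" "0 < a" "a \<le> 1"
  shows "(\<lambda>k. taylor_coeff c a k * (- c) ^ k) sums 0"
proof -
  have "(\<lambda>k. c powr a * ((a gchoose k) * (- 1) ^ k)) sums (c powr a * 0)"
    by (intro sums_mult gbinomial_alternating_sums_zero assms)
  moreover have "c powr a * ((a gchoose k) * (- 1) ^ k) = taylor_coeff c a k * (- c) ^ k" for k
    using assms by (simp add: taylor_coeff_def power_minus[of c])
  ultimately show ?thesis by simp
qed

section \<open>Powers of matrices and Jordan blocks\<close>

lemma mult_mat_entry3:
  fixes P :: "'b :: comm_semiring_1 mat"
  assumes "P \<in> carrier_mat n n" "X \<in> carrier_mat n n" "Q \<in> carrier_mat n n" "i < n" "j < n"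
  shows "(P * X * Q) $$ (i, j) = (\<Sum>a<n. \<Sum>b<n. P $$ (i, a) * X $$ (a, b) * Q $$ (b, j))"
  using assms by (simp add: scalar_prod_def sum_distrib_left mult.assoc lessThan_atLeast0)

text \<open>The maximal absolute row sum is a submultiplicative norm.\<close>

lemma row_sum_pow_mat:
  fixes M :: "real mat"
  assumes M: "M \<in> carrier_mat n n" and c: "0 \<le> c"
    and row: "\<And>i. i < n \<Longrightarrow> (\<Sum>j<n. \<bar>M $$ (i, j)\<bar>) \<le> c"
    and i: "i < n"
  shows "(\<Sum>j<n. \<bar>(M ^\<^sub>m k) $$ (i, j)\<bar>) \<le> c ^ k"
proof (induction k)
  case 0
  have "(\<Sum>j<n. \<bar>(1\<^sub>m n :: real mat) $$ (i, j)\<bar>) = (\<Sum>j<n. if i = j then 1 else 0)"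
    by (rule sum.cong) (use i in auto)
  then show ?case using M i by simp
next
  case (Suc k)
  have "(\<Sum>j<n. \<bar>(M ^\<^sub>m Suc k) $$ (i, j)\<bar>) = (\<Sum>j<n. \<bar>\<Sum>l<n. (M ^\<^sub>m k) $$ (i, l) * M $$ (l, j)\<bar>)"
    using M i by (intro sum.cong) (auto simp: scalar_prod_def lessThan_atLeast0)
  also have "\<dots> \<le> (\<Sum>j<n. \<Sum>l<n. \<bar>(M ^\<^sub>m k) $$ (i, l)\<bar> * \<bar>M $$ (l, j)\<bar>)"
    by (intro sum_mono order_trans[OF sum_abs]) (auto simp: abs_mult)
  also have "\<dots> = (\<Sum>l<n. \<bar>(M ^\<^sub>m k) $$ (i, l)\<bar> * (\<Sum>j<n. \<bar>M $$ (l, j)\<bar>))"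
    by (subst sum.swap) (simp add: sum_distrib_left)
  also have "\<dots> \<le> (\<Sum>l<n. \<bar>(M ^\<^sub>m k) $$ (i, l)\<bar> * c)"
    by (intro sum_mono mult_left_mono row) auto
  also have "\<dots> \<le> c ^ k * c"
    unfolding sum_distrib_right[symmetric] by (intro mult_right_mono Suc.IH c)
  finally show ?case by (simp add: mult.commute)
qed

lemma abs_pow_mat_entry_le:
  fixes M :: "real mat"
  assumes "M \<in> carrier_mat n n" "0 \<le> c"
    "\<And>i. i < n \<Longrightarrow> (\<Sum>j<n. \<bar>M $$ (i, j)\<bar>) \<le> c" "i < n" "j < n"
  shows "\<bar>(M ^\<^sub>m k) $$ (i, j)\<bar> \<le> c ^ k"
proof -
  have "\<bar>(M ^\<^sub>m k) $$ (i, j)\<bar> \<le> (\<Sum>j<n. \<bar>(M ^\<^sub>m k) $$ (i, j)\<bar>)"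
    by (rule member_le_sum) (use assms in auto)
  then show ?thesis using row_sum_pow_mat[OF assms(1-4), of k] by simp
qed

section \<open>Entries of block diagonal matrices\<close>

lemma diag_block_mat_map_carrier:
  assumes "\<And>x. x \<in> set xs \<Longrightarrow> g x \<in> carrier_mat (d x) (d x)"
  shows "diag_block_mat (map g xs) \<in> carrier_mat (\<Sum>x\<leftarrow>xs. d x) (\<Sum>x\<leftarrow>xs. d x)"
  using assms by (induction xs) (auto simp: Let_def dim_diag_block_mat)

lemma diag_block_mat_Cons_entry:
  assumes "\<And>z. z \<in> set (y # xs) \<Longrightarrow> g z \<in> carrier_mat (d z) (d z)"
    and "i < d y + (\<Sum>x\<leftarrow>xs. d x)" "j < d y + (\<Sum>x\<leftarrow>xs. d x)"
  shows "diag_block_mat (map g (y # xs)) $$ (i, j) =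
      (if i < d y then if j < d y then g y $$ (i, j) else 0
       else if j < d y then 0 else diag_block_mat (map g xs) $$ (i - d y, j - d y))"
proof -
  have "g y \<in> carrier_mat (d y) (d y)"
    "diag_block_mat (map g xs) \<in> carrier_mat (\<Sum>x\<leftarrow>xs. d x) (\<Sum>x\<leftarrow>xs. d x)"
    using assms by (auto intro!: diag_block_mat_map_carrier)
  then show ?thesis using assms(2,3) by (auto simp: Let_def)
qed

text \<open>The position \<open>(i', j')\<close> is fixed before the family \<open>g\<close> of
  blocks, so a single position serves all powers of the Jordan blocks at once.\<close>

lemma diag_block_mat_contains_block:
  assumes "x \<in> set xs" "i < d x" "j < d x"
  obtains i' j' where "i' < (\<Sum>x\<leftarrow>xs. d x)" "j' < (\<Sum>x\<leftarrow>xs. d x)"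
    "\<And>g :: 'x \<Rightarrow> 'b :: zero mat. (\<And>x. x \<in> set xs \<Longrightarrow> g x \<in> carrier_mat (d x) (d x)) \<Longrightarrow>
      diag_block_mat (map g xs) $$ (i', j') = g x $$ (i, j)"
  using assms
proof (induction xs arbitrary: thesis)
  case (Cons y xs)
  show ?case
  proof (cases "x = y")
    case True
    show ?thesis
    proof (rule Cons.prems(1)[of i j])
      fix g :: "'x \<Rightarrow> 'b mat"
      assume g: "\<And>z. z \<in> set (y # xs) \<Longrightarrow> g z \<in> carrier_mat (d z) (d z)"
      show "diag_block_mat (map g (y # xs)) $$ (i, j) = g x $$ (i, j)"
        by (subst diag_block_mat_Cons_entry[where d = d]) (use Cons.prems True g in auto)
    qed (use Cons.prems True in auto)
  next
    case False
    then have "x \<in> set xs" using Cons.prems by simp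
    from Cons.IH[OF _ this Cons.prems(3,4)] obtain i' j' where ij:
      "i' < (\<Sum>x\<leftarrow>xs. d x)" "j' < (\<Sum>x\<leftarrow>xs. d x)"
      "\<And>g :: 'x \<Rightarrow> 'b mat. (\<And>x. x \<in> set xs \<Longrightarrow> g x \<in> carrier_mat (d x) (d x)) \<Longrightarrow>
        diag_block_mat (map g xs) $$ (i', j') = g x $$ (i, j)" by blast
    show ?thesis
    proof (rule Cons.prems(1)[of "d y + i'" "d y + j'"])
      fix g :: "'x \<Rightarrow> 'b mat"
      assume g: "\<And>z. z \<in> set (y # xs) \<Longrightarrow> g z \<in> carrier_mat (d z) (d z)"
      show "diag_block_mat (map g (y # xs)) $$ (d y + i', d y + j') = g x $$ (i, j)"
        by (subst diag_block_mat_Cons_entry[where d = d]) (use ij g in auto)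
    qed (use ij in auto)
  qed
qed simp

text \<open>The case distinction depends on the block sizes alone. Thus the powers of the Jordan
  blocks and the blocks of the matrix function can be compared at the same position.\<close>

lemma diag_block_mat_entry_cases:
  fixes xs :: "'x list" and d :: "'x \<Rightarrow> nat"
  assumes "i < (\<Sum>x\<leftarrow>xs. d x)" "j < (\<Sum>x\<leftarrow>xs. d x)"
  obtains (zero) "\<And>g :: 'x \<Rightarrow> 'b :: zero mat. (\<And>x. x \<in> set xs \<Longrightarrow> g x \<in> carrier_mat (d x) (d x)) \<Longrightarrow>
      diag_block_mat (map g xs) $$ (i, j) = 0"
  | (block) x i' j' where "x \<in> set xs" "i' < d x" "j' < d x"
    "\<And>g :: 'x \<Rightarrow> 'b :: zero mat. (\<And>x. x \<in> set xs \<Longrightarrow> g x \<in> carrier_mat (d x) (d x)) \<Longrightarrow>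
      diag_block_mat (map g xs) $$ (i, j) = g x $$ (i', j')"
  using assms
proof (induction xs arbitrary: i j thesis)
  case (Cons y xs)
  let ?N = "\<Sum>x\<leftarrow>xs. d x"
  have ij: "i < d y + ?N" "j < d y + ?N" using Cons.prems by auto
  note entry = diag_block_mat_Cons_entry[OF _ ij]
  consider "i < d y" "j < d y" | "(i < d y) \<noteq> (j < d y)" | "\<not> i < d y" "\<not> j < d y" by blast
  then show ?case
  proof cases
    case 1
    have "diag_block_mat (map g (y # xs)) $$ (i, j) = g y $$ (i, j)"
      if "\<And>z. z \<in> set (y # xs) \<Longrightarrow> g z \<in> carrier_mat (d z) (d z)" for g :: "'x \<Rightarrow> 'b mat"
      using entry[OF that] 1 by (simp del: diag_block_mat.simps list.map)
    then show ?thesis by (rule Cons.prems(2)[rotated 3]) (use 1 in auto)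
  next
    case 2
    have "diag_block_mat (map g (y # xs)) $$ (i, j) = 0"
      if "\<And>z. z \<in> set (y # xs) \<Longrightarrow> g z \<in> carrier_mat (d z) (d z)" for g :: "'x \<Rightarrow> 'b mat"
      using entry[OF that] 2 by (auto simp del: diag_block_mat.simps list.map)
    then show ?thesis by (rule Cons.prems(1))
  next
    case 3
    then have lt: "i - d y < ?N" "j - d y < ?N" using ij by auto
    have shift: "diag_block_mat (map g (y # xs)) $$ (i, j) = diag_block_mat (map g xs) $$ (i - d y, j - d y)"
      if "\<And>z. z \<in> set (y # xs) \<Longrightarrow> g z \<in> carrier_mat (d z) (d z)" for g :: "'x \<Rightarrow> 'b mat"
      using entry[OF that] 3 by (simp del: diag_block_mat.simps list.map)
    show ?thesis
    proof (rule Cons.IH[OF _ _ lt])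
      assume z: "\<And>g :: 'x \<Rightarrow> 'b mat. (\<And>x. x \<in> set xs \<Longrightarrow> g x \<in> carrier_mat (d x) (d x)) \<Longrightarrow>
        diag_block_mat (map g xs) $$ (i - d y, j - d y) = 0"
      have "diag_block_mat (map g (y # xs)) $$ (i, j) = 0"
        if "\<And>z. z \<in> set (y # xs) \<Longrightarrow> g z \<in> carrier_mat (d z) (d z)" for g :: "'x \<Rightarrow> 'b mat"
        using shift[OF that] z[of g] that by (simp del: diag_block_mat.simps list.map)
      then show ?thesis by (rule Cons.prems(1))
    next
      fix x i' j'
      assume x: "x \<in> set xs" "i' < d x" "j' < d x"
        and z: "\<And>g :: 'x \<Rightarrow> 'b mat. (\<And>x. x \<in> set xs \<Longrightarrow> g x \<in> carrier_mat (d x) (d x)) \<Longrightarrow>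
        diag_block_mat (map g xs) $$ (i - d y, j - d y) = g x $$ (i', j')"
      have "diag_block_mat (map g (y # xs)) $$ (i, j) = g x $$ (i', j')"
        if "\<And>z. z \<in> set (y # xs) \<Longrightarrow> g z \<in> carrier_mat (d z) (d z)" for g :: "'x \<Rightarrow> 'b mat"
        using shift[OF that] z[of g] that by (simp del: diag_block_mat.simps list.map)
      then show ?thesis by (rule Cons.prems(2)[rotated 3]) (use x in auto)
    qed
  qed
qed simp

section \<open>Powers of a shifted matrix in Jordan form\<close>

lemma char_matrix_jordan_matrix:
  "char_matrix (jordan_matrix bs) c = jordan_matrix (map (\<lambda>(m, \<mu>). (m, \<mu> - c)) bs)"
proof (induction bs)
  case Nil
  show ?case by (auto simp: jordan_matrix_def char_matrix_def)
next
  case (Cons b bs)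
  obtain m \<mu> where b: "b = (m, \<mu>)" by force
  let ?J = "jordan_matrix bs" and ?N = "\<Sum>x\<leftarrow>bs. fst x"
  have "char_matrix (jordan_matrix (b # bs)) c =
    char_matrix (four_block_mat (jordan_block m \<mu>) (0\<^sub>m m ?N) (0\<^sub>m ?N m) ?J) c"
    by (simp add: b jordan_matrix_Cons)
  also have "\<dots> = four_block_mat (char_matrix (jordan_block m \<mu>) c) (0\<^sub>m m ?N) (0\<^sub>m ?N m) (char_matrix ?J c)"
    by (rule eq_matI) (auto simp: char_matrix_def)
  also have "\<dots> = jordan_matrix (map (\<lambda>(m, \<mu>). (m, \<mu> - c)) (b # bs))"
    unfolding Cons.IH char_matrix_jordan_block
    by (simp add: b jordan_matrix_Cons o_def case_prod_beta)
  finally show ?case .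
qed

text \<open>Both directions matter: the second equation transfers bounds from the matrix powers to
  the blocks, the first transfers the summed series from the blocks back to the matrix.\<close>

lemma shifted_jordan_pow:
  fixes A :: "complex mat" and c :: complex
  assumes A: "A \<in> carrier_mat n n" and wit: "similar_mat_wit A (jordan_matrix bs) Z Z'"
  defines "J \<equiv> \<lambda>k. diag_block_mat (map (\<lambda>(m, \<mu>). jordan_block m (\<mu> - c) ^\<^sub>m k) bs)"
  shows "char_matrix A c ^\<^sub>m k = Z * J k * Z'" "J k = Z' * char_matrix A c ^\<^sub>m k * Z"
    "J k \<in> carrier_mat n n" "(\<Sum>b\<leftarrow>bs. fst b) = n"
proof -
  have J: "jordan_matrix (map (\<lambda>(m, \<mu>). (m, \<mu> - c)) bs) ^\<^sub>m k = J k"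
    unfolding jordan_matrix_pow J_def by (simp add: o_def case_prod_unfold)
  have wit': "similar_mat_wit (char_matrix A c ^\<^sub>m k) (J k) Z Z'"
    using similar_mat_wit_pow[OF similar_mat_wit_char_matrix[OF wit, of c], of k]
    unfolding char_matrix_jordan_matrix J .
  have cA: "char_matrix A c ^\<^sub>m k \<in> carrier_mat n n" using A by simp
  show "char_matrix A c ^\<^sub>m k = Z * J k * Z'" "J k \<in> carrier_mat n n"
    using similar_mat_witD2[OF cA wit'] by auto
  show "J k = Z' * char_matrix A c ^\<^sub>m k * Z"
    using similar_mat_witD2[OF \<open>J k \<in> carrier_mat n n\<close> similar_mat_wit_sym[OF wit']] by auto
  show "(\<Sum>b\<leftarrow>bs. fst b) = n"
    using carrier_matD(1)[OF similar_mat_witD2(5)[OF A wit]] by simp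
qed

section \<open>Growth of the Jordan block powers and location of the eigenvalues\<close>

lemma char_matrix_of_real:
  assumes "L \<in> carrier_mat n n"
  shows "char_matrix (map_mat complex_of_real L) (complex_of_real c) = map_mat complex_of_real (char_matrix L c)"
  using assms by (intro eq_matI) (auto simp: char_matrix_def)

text \<open>The entry sits at a fixed position of \<open>Z' * H^k * Z\<close>, where the entries of
  \<open>H^k\<close> are at most \<open>c^k\<close>. The constant \<open>C\<close> collects the row
  of \<open>Z'\<close> and the column of \<open>Z\<close> involved and is independent of
  \<open>k\<close>.\<close>

lemma jordan_block_pow_le:
  fixes L :: "real mat"
  assumes L: "L \<in> carrier_mat n n" and c: "0 \<le> c"
    and row: "\<And>i. i < n \<Longrightarrow> (\<Sum>j<n. \<bar>char_matrix L c $$ (i, j)\<bar>) \<le> c"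
    and wit: "similar_mat_wit (map_mat complex_of_real L) (jordan_matrix bs) Z Z'"
    and b: "(m, \<mu>) \<in> set bs" "i < m" "j < m"
  obtains C where "\<And>k. cmod ((jordan_block m (\<mu> - of_real c) ^\<^sub>m k) $$ (i, j)) \<le> C * c ^ k"
proof -
  let ?A = "map_mat complex_of_real L" and ?H = "char_matrix L c"
  let ?J = "\<lambda>k. diag_block_mat (map (\<lambda>(m, \<mu>). jordan_block m (\<mu> - complex_of_real c) ^\<^sub>m k) bs)"
  have A: "?A \<in> carrier_mat n n" using L by simp
  have N: "(\<Sum>b\<leftarrow>bs. fst b) = n" by (rule shifted_jordan_pow(4)[OF A wit])
  have "i < fst (m, \<mu>)" "j < fst (m, \<mu>)" using b by auto
  from diag_block_mat_contains_block[where d = fst, OF b(1) this, where ?'b = complex, unfolded N]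
  obtain i' j' where ij: "i' < n" "j' < n" and entry:
    "\<And>g :: nat \<times> complex \<Rightarrow> complex mat. (\<And>x. x \<in> set bs \<Longrightarrow> g x \<in> carrier_mat (fst x) (fst x)) \<Longrightarrow>
      diag_block_mat (map g bs) $$ (i', j') = g (m, \<mu>) $$ (i, j)" by blast
  define C where "C = (\<Sum>a<n. \<Sum>b<n. cmod (Z' $$ (i', a)) * cmod (Z $$ (b, j')))"
  have "cmod ((jordan_block m (\<mu> - of_real c) ^\<^sub>m k) $$ (i, j)) \<le> C * c ^ k" for k
  proof -
    have H: "?H ^\<^sub>m k \<in> carrier_mat n n" "dim_row ?H = n" "dim_col ?H = n"
      using carrier_matD[OF char_matrix_closed[OF L, of c]] L by simp_all
    have pow: "char_matrix ?A (of_real c) ^\<^sub>m k = map_mat complex_of_real (?H ^\<^sub>m k)"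
      unfolding char_matrix_of_real[OF L]
      by (rule of_real_hom.mat_hom_pow[symmetric, of _ n]) (use L in simp)
    have "(jordan_block m (\<mu> - of_real c) ^\<^sub>m k) $$ (i, j) = ?J k $$ (i', j')"
      by (subst entry) auto
    also have "\<dots> = (\<Sum>a<n. \<Sum>b<n. Z' $$ (i', a) * of_real ((?H ^\<^sub>m k) $$ (a, b)) * Z $$ (b, j'))"
      unfolding shifted_jordan_pow(2)[OF A wit] pow
      using similar_mat_witD2(6,7)[OF A wit] H ij
      by (subst mult_mat_entry3[of _ n]) (auto simp del: pow_carrier_mat intro!: sum.cong)
    also have "cmod \<dots> \<le> (\<Sum>a<n. \<Sum>b<n. cmod (Z' $$ (i', a)) * cmod (Z $$ (b, j')) * c ^ k)"
    proof (rule sum_norm_le, rule sum_norm_le)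
      fix a b assume "a \<in> {..<n}" "b \<in> {..<n}"
      then have "\<bar>(?H ^\<^sub>m k) $$ (a, b)\<bar> \<le> c ^ k"
        using L by (intro abs_pow_mat_entry_le[OF _ c row]) auto
      then have "cmod (Z' $$ (i', a)) * \<bar>(?H ^\<^sub>m k) $$ (a, b)\<bar> * cmod (Z $$ (b, j'))
          \<le> cmod (Z' $$ (i', a)) * c ^ k * cmod (Z $$ (b, j'))"
        by (intro mult_left_mono mult_right_mono) auto
      then show "cmod (Z' $$ (i', a) * of_real ((?H ^\<^sub>m k) $$ (a, b)) * Z $$ (b, j'))
        \<le> cmod (Z' $$ (i', a)) * cmod (Z $$ (b, j')) * c ^ k"
        by (simp add: norm_mult mult_ac)
    qed
    finally show ?thesis by (simp add: C_def sum_distrib_right)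
  qed
  then show ?thesis by (rule that)
qed

lemma le_if_power_le:
  fixes x c C :: real
  assumes "0 < c" "\<And>k. x ^ k \<le> C * c ^ k"
  shows "x \<le> c"
proof (rule ccontr)
  assume "\<not> x \<le> c"
  then have "1 < x / c" using assms by simp
  then obtain k where "C < (x / c) ^ k" using real_arch_pow by blast
  then show False using assms(2)[of k] assms(1) by (simp add: power_divide field_simps)
qed

text \<open>
  The entries of the powers of the block of \<open>L - x I\<close> are \<open>O(x\<^sup>k)\<close>. On the diagonal this gives
  \<open>|\<mu> - x| \<le> x\<close>, and using a smaller \<open>x = c'\<close> makes the inequality at \<open>c\<close> strict unless \<open>\<mu> = 0\<close>; for
  \<open>\<mu> = 0\<close> a superdiagonal entry, of absolute value \<open>k x\<^sup>k\<^sup>-\<^sup>1\<close>, would be unbounded relative to \<open>x\<^sup>k\<close>.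
\<close>

lemma jordan_block_location:
  fixes L :: "real mat"
  assumes L: "L \<in> carrier_mat n n" and c: "0 < c'" "c' < c"
    and row: "\<And>i x. i < n \<Longrightarrow> c' \<le> x \<Longrightarrow> (\<Sum>j<n. \<bar>char_matrix L x $$ (i, j)\<bar>) \<le> x"
    and wit: "similar_mat_wit (map_mat complex_of_real L) (jordan_matrix bs) Z Z'"
    and b: "(m, \<mu>) \<in> set bs" "0 < m"
  shows "cmod (\<mu> - of_real c) < c \<or> \<mu> = 0 \<and> m = 1"
proof (cases "\<mu> = 0")
  case True
  have "m = 1"
  proof (rule ccontr)
    assume "m \<noteq> 1"
    then have m: "1 < m" using b by simp
    obtain C where C: "\<And>k. cmod ((jordan_block m (\<mu> - of_real c') ^\<^sub>m k) $$ (0, 1)) \<le> C * c' ^ k"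
      by (rule jordan_block_pow_le[OF L _ row wit b, of c' 1]) (use c m in auto)
    obtain k :: nat where k: "C * c' < real k" using reals_Archimedean2 by blast
    have "cmod ((jordan_block m (\<mu> - of_real c') ^\<^sub>m Suc k) $$ (0, 1)) = real (Suc k) * c' ^ k"
      using True m c by (simp add: jordan_block_pow norm_mult norm_power del: of_nat_Suc pow_mat.simps)
    then have "real (Suc k) * c' ^ k \<le> C * c' * c' ^ k" using C[of "Suc k"] by (simp add: mult_ac)
    then have "real (Suc k) \<le> C * c'" using c by simp
    then show False using k by simp
  qed
  then show ?thesis using True by simp
next
  case False
  obtain C where C: "\<And>k. cmod ((jordan_block m (\<mu> - of_real c') ^\<^sub>m k) $$ (0, 0)) \<le> C * c' ^ k"
    by (rule jordan_block_pow_le[OF L _ row wit b, of c' 0]) (use c b in auto)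
  have "cmod (\<mu> - of_real c') ^ k \<le> C * c' ^ k" for k
    using C[of k] b by (simp add: jordan_block_pow norm_power)
  then have "cmod (\<mu> - of_real c') \<le> c'" by (rule le_if_power_le[OF c(1)])
  then have "(cmod (\<mu> - of_real c'))\<^sup>2 \<le> c'\<^sup>2" by (intro power_mono) auto
  \<comment> \<open>The squared inequality reads \<open>|\<mu>|^2 \<le> 2 * c' * Re \<mu>\<close>.
    For nonzero \<open>\<mu>\<close> it forces \<open>Re \<mu> > 0\<close>, so the right side grows
    strictly when \<open>c'\<close> is replaced by \<open>c\<close>.\<close>
  then have le: "(Re \<mu>)\<^sup>2 + (Im \<mu>)\<^sup>2 \<le> 2 * c' * Re \<mu>"
    by (simp add: cmod_power2 power2_diff algebra_simps)
  have "0 < (Re \<mu>)\<^sup>2 + (Im \<mu>)\<^sup>2"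
    using False by (simp add: complex_eq_iff sum_power2_gt_zero_iff)
  then have "0 < c' * Re \<mu>" using le by simp
  then have "0 < Re \<mu>" using c by (simp add: zero_less_mult_iff)
  then have "c' * Re \<mu> < c * Re \<mu>" using c by simp
  then have "(cmod (\<mu> - of_real c))\<^sup>2 < c\<^sup>2"
    using le by (simp add: cmod_power2 power2_diff algebra_simps)
  then show ?thesis using c by (intro disjI1 power2_less_imp_less[of _ c]) auto
qed

section \<open>Fractional powers of matrices of Laplacian type\<close>

text \<open>For a Laplacian and large \<open>x\<close> the matrix \<open>I - L / x\<close> is
  stochastic, which motivates \<open>row\<close>. The series is expanded at \<open>c\<close>; the
  row bound at the smaller \<open>c'\<close> places the nonzero eigenvalues strictly inside its disc
  of convergence.\<close>

locale semistochastic_shift =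
  fixes L :: "real mat" and n :: nat and c' c :: real
  assumes L: "L \<in> carrier_mat n n"
    and c: "0 < c'" "c' < c"
    and row: "\<And>i x. i < n \<Longrightarrow> c' \<le> x \<Longrightarrow> (\<Sum>j<n. \<bar>char_matrix L x $$ (i, j)\<bar>) \<le> x"
begin

abbreviation H :: "real mat" where "H \<equiv> char_matrix L c"

definition powr_series :: "real \<Rightarrow> real mat" where
  "powr_series a = mat n n (\<lambda>ij. \<Sum>k. taylor_coeff c a k * (H ^\<^sub>m k) $$ ij)"

lemma powr_series_carrier [simp]: "powr_series a \<in> carrier_mat n n"
  by (simp add: powr_series_def)

text \<open>The growth \<open>c^k\<close> of the matrix power cancels the denominator of the
  coefficient. The remaining \<open>c powr a\<close> is at most \<open>1 + c\<close> for every
  \<open>a\<close> in [0,1], whether or not \<open>c\<close> exceeds 1.\<close>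

lemma term_bound:
  assumes "i < n" "j < n" "0 \<le> a" "a \<le> 1"
  shows "\<bar>taylor_coeff c a k * (H ^\<^sub>m k) $$ (i, j)\<bar> \<le> \<bar>a gchoose k\<bar> * (1 + c)"
proof -
  have "\<bar>(H ^\<^sub>m k) $$ (i, j)\<bar> \<le> c ^ k"
    by (rule abs_pow_mat_entry_le[OF _ _ row]) (use L c assms in auto)
  then have "\<bar>taylor_coeff c a k\<bar> * \<bar>(H ^\<^sub>m k) $$ (i, j)\<bar> \<le> \<bar>taylor_coeff c a k\<bar> * c ^ k"
    by (intro mult_left_mono) auto
  also have "\<dots> = \<bar>a gchoose k\<bar> * c powr a"
    using c by (simp add: taylor_coeff_def abs_mult)
  also have "c powr a \<le> (1 + c) powr a" using assms c by (intro powr_mono2) auto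
  also have "\<dots> \<le> (1 + c) powr 1" using assms c by (intro powr_mono) auto
  finally show ?thesis using c by (simp add: abs_mult mult_left_mono)
qed

lemma powr_series_summable:
  assumes "i < n" "j < n" "0 \<le> a" "a \<le> 1"
  shows "summable (\<lambda>k. taylor_coeff c a k * (H ^\<^sub>m k) $$ (i, j))"
  by (rule summable_comparison_test'[OF summable_mult2[OF summable_abs_gbinomial(1)]])
     (use term_bound assms in auto)

lemma powr_series_bound:
  assumes "i < n" "j < n" "0 \<le> a" "a \<le> 1"
  shows "\<bar>powr_series a $$ (i, j)\<bar> \<le> 2 * (1 + c)"
proof -
  have "norm (\<Sum>k. taylor_coeff c a k * (H ^\<^sub>m k) $$ (i, j)) \<le> (\<Sum>k. \<bar>a gchoose k\<bar> * (1 + c))"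
    by (rule norm_suminf_le[OF _ summable_mult2[OF summable_abs_gbinomial(1)]])
       (use term_bound assms in auto)
  also have "\<dots> = (\<Sum>k. \<bar>a gchoose k\<bar>) * (1 + c)"
    by (rule suminf_mult2[symmetric]) (use summable_abs_gbinomial assms in auto)
  also have "\<dots> \<le> 2 * (1 + c)"
    by (rule mult_right_mono) (use summable_abs_gbinomial assms c in auto)
  finally show ?thesis using assms by (simp add: powr_series_def)
qed

text \<open>On each \<open>[b, 1]\<close> the Weierstrass test applies with the majorant from
  \<open>abs_gbinomial_le\<close>. Every \<open>a\<close> in (0,1] has a neighbourhood relative to
  (0,1] contained in \<open>[a / 2, 1]\<close>.\<close>

lemma powr_series_continuous:
  assumes ij: "i < n" "j < n"
  shows "continuous_on {0<..1} (\<lambda>a. powr_series a $$ (i, j))"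
proof -
  have cont: "continuous_on {b..1} (\<lambda>a. powr_series a $$ (i, j))" if b: "0 < b" for b
  proof (cases "b \<le> 1")
    case True
    have "uniform_limit {b..1} (\<lambda>N a. \<Sum>k<N. taylor_coeff c a k * (H ^\<^sub>m k) $$ (i, j))
        (\<lambda>a. \<Sum>k. taylor_coeff c a k * (H ^\<^sub>m k) $$ (i, j)) sequentially"
    proof (rule Weierstrass_m_test)
      show "summable (\<lambda>k. \<bar>b gchoose k\<bar> / b * (1 + c))"
        using b True by (intro summable_mult2 summable_divide summable_abs_gbinomial) auto
      fix k a assume a: "a \<in> {b..1}"
      have "\<bar>a gchoose k\<bar> * (1 + c) \<le> \<bar>b gchoose k\<bar> / b * (1 + c)"
        using a b c by (intro mult_right_mono abs_gbinomial_le) auto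
      then show "norm (taylor_coeff c a k * (H ^\<^sub>m k) $$ (i, j)) \<le> \<bar>b gchoose k\<bar> / b * (1 + c)"
        using term_bound[OF ij, of a k] a b by simp
    qed
    then have "continuous_on {b..1} (\<lambda>a. \<Sum>k. taylor_coeff c a k * (H ^\<^sub>m k) $$ (i, j))"
      by (rule uniform_limit_theorem[rotated])
         (use c in \<open>auto simp: taylor_coeff_def gbinomial_prod_rev intro!: always_eventually continuous_intros\<close>)
    then show ?thesis using ij by (simp add: powr_series_def)
  qed simp
  show ?thesis
    unfolding continuous_on_eq_continuous_within
  proof
    fix a :: real assume a: "a \<in> {0<..1}"
    then have "continuous (at a within {a / 2..1}) (\<lambda>a. powr_series a $$ (i, j))"
      using cont[of "a / 2"] by (auto simp: continuous_on_eq_continuous_within)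
    moreover have "at a within {a / 2..1} = at a within {0<..1}"
      by (rule at_within_nhd[of _ "{a / 2<..}"]) (use a in auto)
    ultimately show "continuous (at a within {0<..1}) (\<lambda>a. powr_series a $$ (i, j))" by simp
  qed
qed

lemma char_matrix_pow_of_real:
  "char_matrix (map_mat complex_of_real L) (of_real c) ^\<^sub>m k = map_mat complex_of_real (H ^\<^sub>m k)"
  unfolding char_matrix_of_real[OF L]
  by (rule of_real_hom.mat_hom_pow[symmetric, of _ n]) (use L in simp)

text \<open>An eigenvalue inside the disc is covered by the Taylor series of the derivatives.
  Otherwise the block is the single entry 0, and the series at the boundary point has the sum
  \<open>0 = 0 powr a\<close>.\<close>

lemma block_sums:
  assumes wit: "similar_mat_wit (map_mat complex_of_real L) (jordan_matrix bs) Z Z'"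
    and b: "(m, \<mu>) \<in> set bs" "i < m" "j < m" and a: "0 < a" "a \<le> 1"
  shows "(\<lambda>k. of_real (taylor_coeff c a k) * (jordan_block m (\<mu> - of_real c) ^\<^sub>m k) $$ (i, j))
    sums (fun_jordan_block (\<lambda>z. z powr of_real a) m \<mu> $$ (i, j))"
proof (cases "i \<le> j")
  case True
  have entry: "(jordan_block m (\<mu> - of_real c) ^\<^sub>m k) $$ (i, j)
      = of_nat (k choose (j - i)) * (\<mu> - of_real c) ^ (k - (j - i))" for k
    using b True by (simp add: jordan_block_pow)
  have f: "fun_jordan_block (\<lambda>z. z powr of_real a) m \<mu> $$ (i, j)
      = (deriv ^^ (j - i)) (\<lambda>z. z powr of_real a) \<mu> / fact (j - i)"
    using b True by (simp add: fun_jordan_block_def)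
  have "0 < m" using b by simp
  from jordan_block_location[OF L c row wit b(1) this]
  show ?thesis
  proof
    assume "cmod (\<mu> - of_real c) < c"
    then show ?thesis unfolding entry f using c by (intro taylor_coeff_block_sums) auto
  next
    assume z: "\<mu> = 0 \<and> m = 1"
    have "(\<lambda>k. of_real (taylor_coeff c a k * (- c) ^ k)) sums complex_of_real 0"
      using c a by (intro sums_of_real taylor_coeff_sums_zero) auto
    then show ?thesis unfolding entry f using z b by simp
  qed
next
  case False
  then show ?thesis using b by (simp add: jordan_block_pow fun_jordan_block_def)
qed

text \<open>The right side mentions neither \<open>bs\<close> nor \<open>Z\<close> nor
  \<open>Z'\<close>: conjugating the block series turns it into a series in the powers of
  \<open>H\<close>. Hence all Jordan decompositions give the same matrix.\<close>

lemma matrix_function_eq: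
  assumes B: "is_matrix_function (\<lambda>z. z powr of_real a) (map_mat complex_of_real L) B"
    and a: "0 < a" "a \<le> 1"
  shows "B = map_mat complex_of_real (powr_series a)"
proof -
  let ?A = "map_mat complex_of_real L" and ?f = "\<lambda>z. z powr complex_of_real a"
  let ?F = "\<lambda>(m, \<mu>). fun_jordan_block ?f m \<mu>"
  obtain bs Z Z' where wit: "similar_mat_wit ?A (jordan_matrix bs) Z Z'"
    and B_eq: "B = Z * diag_block_mat (map ?F bs) * Z'"
    using B unfolding is_matrix_function_def by blast
  define J where "J k = diag_block_mat (map (\<lambda>(m, \<mu>). jordan_block m (\<mu> - complex_of_real c) ^\<^sub>m k) bs)" for k
  define F where "F = diag_block_mat (map ?F bs)"
  have A: "?A \<in> carrier_mat n n" using L by simp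
  note pow = shifted_jordan_pow(1-3)[OF A wit, where c = "of_real c", folded J_def]
  note N = shifted_jordan_pow(4)[OF A wit]
  note ZZ = similar_mat_witD2(6,7)[OF A wit]
  have "F \<in> carrier_mat (\<Sum>b\<leftarrow>bs. fst b) (\<Sum>b\<leftarrow>bs. fst b)"
    unfolding F_def by (rule diag_block_mat_map_carrier) (auto simp: fun_jordan_block_def)
  then have F: "F \<in> carrier_mat n n" unfolding N .
  have sums: "(\<lambda>k. of_real (taylor_coeff c a k) * J k $$ (i, j)) sums F $$ (i, j)"
    if "i < n" "j < n" for i j
  proof -
    have ij: "i < (\<Sum>b\<leftarrow>bs. fst b)" "j < (\<Sum>b\<leftarrow>bs. fst b)" using that unfolding N .
    have car: "(case x of (m, \<mu>) \<Rightarrow> jordan_block m (\<mu> - complex_of_real c) ^\<^sub>m k) \<in> carrier_mat (fst x) (fst x)"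
      "?F x \<in> carrier_mat (fst x) (fst x)" for x k
      by (auto simp: fun_jordan_block_def split: prod.splits)
    show ?thesis
    proof (rule diag_block_mat_entry_cases[OF ij, where ?'b = complex])
      assume z: "\<And>g :: nat \<times> complex \<Rightarrow> complex mat.
        (\<And>x. x \<in> set bs \<Longrightarrow> g x \<in> carrier_mat (fst x) (fst x)) \<Longrightarrow> diag_block_mat (map g bs) $$ (i, j) = 0"
      show ?thesis unfolding J_def F_def z[OF car(1)] z[OF car(2)] by simp
    next
      fix x i' j'
      assume x: "x \<in> set bs" "i' < fst x" "j' < fst x"
        and z: "\<And>g :: nat \<times> complex \<Rightarrow> complex mat.
        (\<And>x. x \<in> set bs \<Longrightarrow> g x \<in> carrier_mat (fst x) (fst x)) \<Longrightarrow>
          diag_block_mat (map g bs) $$ (i, j) = g x $$ (i', j')"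
      obtain m \<mu> where "x = (m, \<mu>)" by force
      then show ?thesis
        unfolding J_def F_def z[OF car(1)] z[OF car(2)]
        using block_sums[OF wit _ _ _ a, of m \<mu> i' j'] x by simp
    qed
  qed
  have BF: "B = Z * F * Z'" unfolding B_eq F_def ..
  show ?thesis
  proof (rule eq_matI)
    fix i j assume "i < dim_row (map_mat complex_of_real (powr_series a))"
      "j < dim_col (map_mat complex_of_real (powr_series a))"
    then have ij: "i < n" "j < n" by (auto simp: powr_series_def)
    \<comment> \<open>Each entry of the conjugated matrix is a finite linear combination of the
      convergent entry series, so conjugation commutes with the summation.\<close>
    have "(\<lambda>k. \<Sum>p<n. \<Sum>q<n. Z $$ (i, p) * (of_real (taylor_coeff c a k) * J k $$ (p, q)) * Z' $$ (q, j))
        sums (\<Sum>p<n. \<Sum>q<n. Z $$ (i, p) * F $$ (p, q) * Z' $$ (q, j))"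
      by (intro sums_sum sums_mult sums_mult2 sums) auto
    also have "(\<Sum>p<n. \<Sum>q<n. Z $$ (i, p) * F $$ (p, q) * Z' $$ (q, j)) = B $$ (i, j)"
      unfolding BF by (rule mult_mat_entry3[symmetric]) (use ZZ F ij in auto)
    also have "(\<lambda>k. \<Sum>p<n. \<Sum>q<n. Z $$ (i, p) * (of_real (taylor_coeff c a k) * J k $$ (p, q)) * Z' $$ (q, j))
        = (\<lambda>k. of_real (taylor_coeff c a k * (H ^\<^sub>m k) $$ (i, j)))"
    proof
      fix k
      have "complex_of_real ((H ^\<^sub>m k) $$ (i, j)) = (Z * J k * Z') $$ (i, j)"
        unfolding pow(1)[symmetric] char_matrix_pow_of_real
        using ij carrier_matD[OF pow_carrier_mat[OF char_matrix_closed[OF L, of c], of k]] by simp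
      also have "\<dots> = (\<Sum>p<n. \<Sum>q<n. Z $$ (i, p) * J k $$ (p, q) * Z' $$ (q, j))"
        by (rule mult_mat_entry3) (use ZZ pow(3) ij in auto)
      finally show "(\<Sum>p<n. \<Sum>q<n. Z $$ (i, p) * (of_real (taylor_coeff c a k) * J k $$ (p, q)) * Z' $$ (q, j))
        = of_real (taylor_coeff c a k * (H ^\<^sub>m k) $$ (i, j))"
        by (simp add: sum_distrib_left mult_ac)
    qed
    finally have "(\<lambda>k. complex_of_real (taylor_coeff c a k * (H ^\<^sub>m k) $$ (i, j))) sums B $$ (i, j)" .
    moreover have "(\<lambda>k. complex_of_real (taylor_coeff c a k * (H ^\<^sub>m k) $$ (i, j)))
        sums of_real (powr_series a $$ (i, j))"
      using summable_sums[OF powr_series_summable[OF ij, of a]] a ij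
      by (intro sums_of_real) (simp add: powr_series_def)
    ultimately show "B $$ (i, j) = map_mat complex_of_real (powr_series a) $$ (i, j)"
      using ij carrier_matD[OF powr_series_carrier[of a]] by (simp add: sums_unique2)
  qed (use BF ZZ carrier_matD[OF powr_series_carrier[of a]] in auto)
qed

text \<open>The characteristic polynomial splits over the complex numbers, which provides a Jordan
  form. It remains to check that the required derivatives exist.\<close>

lemma matrix_function_exists:
  "\<exists>B. is_matrix_function (\<lambda>z. z powr of_real a) (map_mat complex_of_real L) B"
proof -
  let ?A = "map_mat complex_of_real L" and ?f = "\<lambda>z. z powr complex_of_real a"
  have A: "?A \<in> carrier_mat n n" using L by simp
  obtain es where "char_poly ?A = (\<Prod>e\<leftarrow>es. [:- e, 1:])" using char_poly_factorized[OF A] by blast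
  then obtain bs where "jordan_nf ?A bs" using jordan_nf_exists[OF A] by blast
  then obtain Z Z' where bs: "0 \<notin> fst ` set bs" and wit: "similar_mat_wit ?A (jordan_matrix bs) Z Z'"
    unfolding jordan_nf_def similar_mat_def by blast
  have "(deriv ^^ j) ?f field_differentiable at \<mu>" if "(m, \<mu>) \<in> set bs" "Suc j < m" for m \<mu> j
  proof -
    \<comment> \<open>\<open>Suc j < m\<close> excludes blocks of size 1, and with them the
      eigenvalue 0, so only the open disc off the branch cut is left.\<close>
    have "\<mu> \<in> ball (of_real c) c"
      using jordan_block_location[OF L c row wit that(1)] that(2)
      by (auto simp: dist_norm norm_minus_commute)
    moreover have "(deriv ^^ j) ?f holomorphic_on ball (of_real c) c"
      by (intro holomorphic_higher_deriv powr_holomorphic_on_ball) auto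
    ultimately show ?thesis by (auto intro: holomorphic_on_imp_differentiable_at)
  qed
  then show ?thesis unfolding is_matrix_function_def using bs wit by blast
qed

lemma mat_powr_eq:
  assumes "0 < a" "a \<le> 1"
  shows "mat_powr L a = map_mat complex_of_real (powr_series a)"
proof -
  obtain B where B: "is_matrix_function (\<lambda>z. z powr of_real a) (map_mat complex_of_real L) B"
    using matrix_function_exists by blast
  show ?thesis
    unfolding mat_powr_def matrix_function_def
    by (rule the_equality) (use B matrix_function_eq assms in auto)
qed

end

section \<open>The Cauchy problem for the Laplacian\<close>

text \<open>The out-degree is at most \<open>n < x\<close>, so the diagonal entries of
  \<open>L - x I\<close> are nonpositive. The absolute values of row \<open>i\<close> therefore sum
  to \<open>deg i + (x - deg i) = x\<close>, for directed graphs as well.\<close>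

lemma laplacian_semistochastic_shift:
  "semistochastic_shift (laplacian_mat G n v) n (real n + 1) (real n + 2)"
proof
  define A where "A = (\<lambda>i j. if (v i, v j) \<in> parcs G then 1 else 0 :: real)"
  define deg where "deg = (\<lambda>i. \<Sum>j<n. A i j)"
  show car: "laplacian_mat G n v \<in> carrier_mat n n"
    by (simp add: laplacian_mat_def adjacency_mat_def Let_def minus_carrier_mat)
  have entry: "laplacian_mat G n v $$ (i, j) = (if i = j then deg i else 0) - A i j"
    if "i < n" "j < n" for i j
    using that
    by (simp add: laplacian_mat_def adjacency_mat_def mat_diag_def Let_def scalar_prod_def
        deg_def A_def lessThan_atLeast0)
  fix i x assume i: "i < n" and x: "real n + 1 \<le> x"
  have A: "0 \<le> A i j" "A i j \<le> 1" for j by (auto simp: A_def)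
  have "deg i \<le> (\<Sum>j<n. 1)" unfolding deg_def by (rule sum_mono) (rule A)
  then have deg: "deg i \<le> x" using x by simp
  have abs_entry: "\<bar>char_matrix (laplacian_mat G n v) x $$ (i, j)\<bar> = A i j + (if i = j then x - deg i else 0)"
    if "j < n" for j
    using i that car deg A[of j] by (auto simp: char_matrix_def entry)
  have "(\<Sum>j<n. \<bar>char_matrix (laplacian_mat G n v) x $$ (i, j)\<bar>)
      = (\<Sum>j<n. A i j + (if i = j then x - deg i else 0))"
    by (rule sum.cong) (use abs_entry in auto)
  also have "\<dots> = x" using i by (simp add: sum.distrib deg_def)
  finally show "(\<Sum>j<n. \<bar>char_matrix (laplacian_mat G n v) x $$ (i, j)\<bar>) \<le> x" by simp
qed auto

lemma row_mult_of_real: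
  assumes "p \<in> carrier_vec n" "M \<in> carrier_mat n n"
  shows "- row_mult (map_vec complex_of_real p) (map_mat complex_of_real M)
    = map_vec complex_of_real (vec n (\<lambda>j. \<Sum>i<n. p $ i * - M $$ (i, j)))"
  using assms
  by (intro eq_vecI) (auto simp: row_mult_def scalar_prod_def lessThan_atLeast0 sum_negf)

theorem theorem3p2:
  fixes G :: "'a pair_pre_digraph" and n :: nat and v :: "nat \<Rightarrow> 'a"
    and \<alpha> :: "real \<Rightarrow> real" and p0 :: "real vec"
  assumes "pair_digraph G"
    and "bij_betw v {..<n} (pverts G)"
    and "continuous_on {0..} \<alpha>"
    and "\<forall>t\<ge>0. 0 < \<alpha> t \<and> \<alpha> t \<le> 1"
    and "p0 \<in> carrier_vec n"
    and "(\<Sum>j<n. p0 $ j) = 1"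
  shows "\<exists>p. cauchy_solution n (laplacian_mat G n v) \<alpha> p0 p \<and>
      (\<forall>q. cauchy_solution n (laplacian_mat G n v) \<alpha> p0 q \<longrightarrow> (\<forall>t\<ge>0. q t = p t))"
proof -
  let ?L = "laplacian_mat G n v"
  interpret semistochastic_shift ?L n "real n + 1" "real n + 2"
    by (rule laplacian_semistochastic_shift)
  define m where "m = (\<lambda>i j t. - powr_series (\<alpha> t) $$ (i, j))"
  have \<alpha>: "0 < \<alpha> t" "\<alpha> t \<le> 1" if "0 \<le> t" for t using assms(4) that by auto
  have m_cont: "continuous_on {0..} (m i j)" if "i < n" "j < n" for i j
    unfolding m_def
    by (intro continuous_on_minus continuous_on_compose2[OF powr_series_continuous[OF that] assms(3)])
       (use \<alpha> in auto)
  have m_bound: "\<bar>m i j t\<bar> \<le> 2 * (1 + (real n + 2))" if "i < n" "j < n" "0 \<le> t" for i j t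
    using powr_series_bound[OF that(1,2)] \<alpha>[OF that(3)] by (simp add: m_def)
  \<comment> \<open>Since \<open>mat_powr\<close> is the image of a real matrix, the complex
    equation is equivalent to a real linear system with coefficients \<open>m\<close>; the converse
    direction uses injectivity of the embedding of the reals.\<close>
  have eq_iff: "map_vec complex_of_real p' = - row_mult (map_vec complex_of_real p) (mat_powr ?L (\<alpha> t))
      \<longleftrightarrow> p' = vec n (\<lambda>j. \<Sum>i<n. p $ i * m i j t)" if "0 < t" "p \<in> carrier_vec n" for p p' t
  proof -
    have "0 < \<alpha> t" "\<alpha> t \<le> 1" using \<alpha> that by auto
    then show ?thesis
      unfolding m_def
      by (auto simp: mat_powr_eq row_mult_of_real[OF that(2) powr_series_carrier] dest: of_real_hom.vec_hom_inj)
  qed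
  obtain P where P0: "\<And>j. j < n \<Longrightarrow> P j 0 = p0 $ j"
    and P': "\<And>j t. j < n \<Longrightarrow> 0 \<le> t \<Longrightarrow>
      (P j has_real_derivative (\<Sum>i<n. P i t * m i j t)) (at t within {0..})"
    using linear_ode_exists[where m = m and a = "\<lambda>j. p0 $ j", OF m_cont m_bound] by blast
  have P_cont: "continuous_on {0..} (P j)" if "j < n" for j
    by (rule DERIV_continuous_on) (use P' that in auto)
  \<comment> \<open>A positive time is interior to \<open>{0..}\<close>, so the one-sided
    formulation becomes an ordinary derivative.\<close>
  have P_der: "(P j has_real_derivative (\<Sum>i<n. P i t * m i j t)) (at t)" if "j < n" "0 < t" for j t
    using P'[of j t] at_within_interior[of t "{0..}"] that by simp
  define p where "p = (\<lambda>t. vec n (\<lambda>j. P j t))"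
  show ?thesis
  proof (intro exI conjI allI impI)
    show "cauchy_solution n ?L \<alpha> p0 p"
      unfolding cauchy_solution_def
    proof (intro conjI exI[of _ "\<lambda>t. vec n (\<lambda>j. \<Sum>i<n. p t $ i * m i j t)"] allI impI)
      fix t :: real assume t: "0 < t"
      show "map_vec complex_of_real (vec n (\<lambda>j. \<Sum>i<n. p t $ i * m i j t))
          = - row_mult (map_vec complex_of_real (p t)) (mat_powr ?L (\<alpha> t))"
        using eq_iff[OF t, of "p t"] by (simp add: p_def)
      show "((\<lambda>s. p s $ j) has_real_derivative vec n (\<lambda>j. \<Sum>i<n. p t $ i * m i j t) $ j) (at t)"
        if "j < n" for j
        using P_der[OF that t] that by (simp add: p_def)
    next
      show "p 0 = p0" using P0 assms(5) by (intro eq_vecI) (auto simp: p_def)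
    qed (use P_cont in \<open>auto simp: p_def\<close>)
  next
    fix q t assume q: "cauchy_solution n ?L \<alpha> p0 q" and t: "(0 :: real) \<le> t"
    obtain q' where q': "\<And>t j. 0 < t \<Longrightarrow> j < n \<Longrightarrow> ((\<lambda>s. q s $ j) has_real_derivative q' t $ j) (at t)"
      "\<And>t. 0 < t \<Longrightarrow> map_vec complex_of_real (q' t)
         = - row_mult (map_vec complex_of_real (q t)) (mat_powr ?L (\<alpha> t))"
      using q unfolding cauchy_solution_def by blast
    have q_car: "q t \<in> carrier_vec n" if "0 \<le> t" for t
      using q that unfolding cauchy_solution_def by blast
    have q_cont: "continuous_on {0..} (\<lambda>t. q t $ j)" if "j < n" for j
      using q that unfolding cauchy_solution_def by blast
    have q0: "q 0 = p0" using q unfolding cauchy_solution_def by blast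
    have q_der: "((\<lambda>s. q s $ j) has_real_derivative (\<Sum>i<n. q t $ i * m i j t)) (at t)"
      if "j < n" "0 < t" for j t
    proof -
      have "q' t = vec n (\<lambda>j. \<Sum>i<n. q t $ i * m i j t)"
        using q'(2)[OF that(2)] eq_iff[OF that(2) q_car] that(2) by simp
      then show ?thesis using q'(1)[OF that(2,1)] that(1) by simp
    qed
    \<comment> \<open>By linearity the difference of the two solutions satisfies the same equation,
      with initial value 0.\<close>
    have "q t $ j - P j t = 0" if j: "j < n" for j
    proof (rule linear_ode_unique[where r = "\<lambda>j t. q t $ j - P j t" and m = m, OF _ m_bound _ _ j t])
      fix j s assume js: "j < n" "(0 :: real) < s"
      show "((\<lambda>t. q t $ j - P j t) has_real_derivative (\<Sum>i<n. (q s $ i - P i s) * m i j s)) (at s)"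
        using DERIV_diff[OF q_der[OF js] P_der[OF js]]
        by (simp add: left_diff_distrib sum_subtractf)
    qed (use q_cont P_cont q0 P0 in \<open>auto intro!: continuous_intros\<close>)
    then show "q t = p t"
      using q_car[OF t] by (intro eq_vecI) (auto simp: p_def)
  qed
qed

end
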